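(* Let $G$ be an edge-point ribbon graph with edge set $E$. Then the polynomial $\Omega(G)\in\mathbb{Z}[w,x,y,z,t]$ defined by the recursion $$\Omega(G)= w\,\Omega(G\odot e)+x\,\Omega(G/e)+y\,\Omega(G\setminus e)+z\,\Omega(G\rightthreetimes e)\quad (e \text{ an edge of } G),\qquad \Omega(G)=t^{\kappa(G)}\ \text{ if } G \text{ is edgeless},$$ satisfies $$\Omega(G)=\sum_{\substack{(A,B,C,D)\text{ an ordered}\\ \text{partition of }E}} w^{|A|}x^{|B|}y^{|C|}z^{|D|}\,t^{\partial(G[A,B,C,D])},$$ where $G[A,B,C,D]:=((((G\odot A)/B)\setminus C)\rightthreetimes D)$ and $\partial(G[A,B,C,D])$ is its number of boundary components.
   Context: **Ribbon graphs.** A ribbon graph $G=(V(G),E(G))$ is a surface with boundary, represented as the union of two sets of discs, a set $V(G)$ of vertices and a set $E(G)$ of edges, such that: (1) the vertices and edges intersect in disjoint line segments; (2) each such line segment lies on the boundary of precisely one vertex and precisely one edge; (3) every edge contains exactly two such line segments. Two ribbon graphs are equivalent if there is a homeomorphism between them (orientation preserving when orientable) mapping vertices to vertices and edges to edges. Let $e\in E(G)$. *Deletion:* $G\setminus e$ is obtained by removing the edge $e$. *Contraction:* if $u,v$ are the (not necessarily distinct) vertices incident with $e$, consider the boundary component(s) of $e\cup\{u,v\}$ as curves on $G$; for each curve attach a disc (a new vertex) by identifying its boundary with the curve, and then delete $e,u,v$; the result is $G/e$. *Partial Petrial:* $G^{\tau(e)}$ is obtained by detaching one end of $e$ from its incident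 vertex $v$, creating arcs $[a,b]$ on $v$ and $[a',b']$ on $e$ (so that $G$ is recovered by identifying $[a,b]$ with $[a',b']$), and reattaching by identifying $[a,b]$ with $[b',a']$ (i.e. giving $e$ a half-twist). *Penrose-contraction:* $G\rightthreetimes e:=G^{\tau(e)}/e$. **Edge-point ribbon graphs.** An edge-point ribbon graph is an object obtained from a ribbon graph $(V,E)$ by contracting each edge (disc) in some (possibly empty) subset $B\subseteq E$ to a point. The points so created are singular points; the images of the edges not in $B$ are the edges of the edge-point ribbon graph; its pinched-vertices are the connected components of the image of the vertices (including the singular points). Equivalently, it is an edge 2-coloured ribbon graph in which dark grey edges represent those contracted to points and light grey edges are the edges of the edge-point ribbon graph. Two edge-point ribbon graphs are equivalent if there is a homeomorphism (orientation preserving when orientable) sending edges to edges and pinched-vertices to pinched-vertices (in the 2-coloured model: up to partial Petrials of dark grey edges). Deletion, contraction, partial Petriality and Penrose-contraction of an edge are inherited by performing the ribbon graph operations on light grey edges in the 2-coloured model; they are not applied to dark grey edges. *Contraction to a point:* for an edge $e$, $G\odot e$ is the edge-point ribbon graph obtained by contracting $e$ to a point (recolouring $e$ dark grey). For a set $A$ of edges, $G\setminus A$, $G/A$, $G\rightthreetimes A$, $G\odot A$ denote the result of applying the operation to every edge of $A$; the operations commute when applied to different edges. $\kappa(G)$ is the number of connected components of $G$. $\partial(G)$ is the number of boundary components of the edge-point ribbon graph as a topological object (i.e. after the dark grey edges have been contracted to points); these are connected components of the boundary and need not be homeomorphic to circles, so $\partial(G)$ is in general not the number of boundary components of a 2-coloured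 ribbon graph representing it. (For example, contracting to a point one edge of the plane theta-graph gives $\partial=2$: one circle and one figure-of-eight.) Members of an ordered partition $(A,B,C,D)$ of $E$ are allowed to be empty. *)

theory Defs
  imports "HOL-Library.Poly_Mapping"
begin

text \<open>
  Ribbon graphs are represented combinatorially, by the cell structure that the definition of a
  ribbon graph puts on its surface.  A vertex is a disc, hence given by its boundary circle.  Each
  of these circles is subdivided by finitely many points into 1-cells that are alternately called
  arcs and segments; \<open>arc\<close> and \<open>seg\<close> send a point to the other end of the arc, respectively the
  segment, that it lies on.  The vertices are thus the orbits of \<open>arc\<close> and \<open>seg\<close>.

  An edge is a disc that meets the vertices in exactly two segments.  Its boundary is a 4-cycle,
  consisting in turn of a segment, a side, a segment and a side.  It is named by the set of its
  four corners, and \<open>side\<close> sends a corner to the other end of its side.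

  Segments that do not lie on an edge are allowed; they are just pieces of vertex boundary.  So an
  isolated vertex is a circle (two points suffice) all of whose segments are of this kind.  The
  values of \<open>arc\<close> and \<open>seg\<close> away from \<open>points\<close>, and of \<open>side\<close> away from the corners, carry no
  meaning.

  An edge-point ribbon graph is given by its edge 2-coloured ribbon graph: \<open>discs\<close> are the edges of
  the ribbon graph and \<open>dark\<close> those among them that are contracted to points.
\<close>

record 'p ep_graph =
  points :: "'p set"
  arc :: "'p \<Rightarrow> 'p"
  seg :: "'p \<Rightarrow> 'p"
  side :: "'p \<Rightarrow> 'p"
  discs :: "'p set set"
  dark :: "'p set set"

definition perfect_matching :: "'p set \<Rightarrow> ('p \<Rightarrow> 'p) \<Rightarrow> bool" where
  "perfect_matching S f \<longleftrightarrow> (\<forall>p\<in>S. f p \<in> S \<and> f p \<noteq> p \<and> f (f p) = p)"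

definition edge_disc :: "'p ep_graph \<Rightarrow> 'p set \<Rightarrow> bool" where
  "edge_disc G e \<longleftrightarrow>
     e \<subseteq> points G \<and> card e = 4 \<and>
     perfect_matching e (seg G) \<and> perfect_matching e (side G) \<and>
     (\<forall>p\<in>e. side G p \<noteq> seg G p)"

definition edge_point_ribbon_graph :: "'p ep_graph \<Rightarrow> bool" where
  "edge_point_ribbon_graph G \<longleftrightarrow>
     finite (points G) \<and>
     perfect_matching (points G) (arc G) \<and>
     perfect_matching (points G) (seg G) \<and>
     (\<forall>e\<in>discs G. edge_disc G e) \<and>
     (\<forall>e\<in>discs G. \<forall>f\<in>discs G. e \<noteq> f \<longrightarrow> e \<inter> f = {}) \<and>
     dark G \<subseteq> discs G"

definition edges :: "'p ep_graph \<Rightarrow> 'p set set" where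
  "edges G = discs G - dark G"

definition corners :: "'p ep_graph \<Rightarrow> 'p set" where
  "corners G = \<Union> (discs G)"


subsection \<open>Operations on an edge\<close>

definition pinch :: "'p ep_graph \<Rightarrow> 'p set \<Rightarrow> 'p ep_graph" (infixl "\<odot>" 70) where
  "G \<odot> e = G\<lparr>dark := insert e (dark G)\<rparr>"

definition delete :: "'p ep_graph \<Rightarrow> 'p set \<Rightarrow> 'p ep_graph" where
  "delete G e = G\<lparr>discs := discs G - {e}\<rparr>"

text \<open>
  If \<open>e\<close> is incident with \<open>u\<close> and \<open>v\<close>, the boundary curves of \<open>e \<union> u \<union> v\<close> run along the boundaries
  of \<open>u\<close> and \<open>v\<close>, except that they follow the sides of \<open>e\<close> instead of its two segments.  These
  curves become vertex boundaries.
\<close>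

definition contract :: "'p ep_graph \<Rightarrow> 'p set \<Rightarrow> 'p ep_graph" where
  "contract G e =
     G\<lparr>seg := (\<lambda>p. if p \<in> e then side G p else seg G p), discs := discs G - {e}\<rparr>"

text \<open>
  Let \<open>a\<close>, \<open>b\<close> be the corners at one end of \<open>e\<close>, with sides leading to \<open>c\<close> and \<open>d\<close> respectively.
  Reattaching this end the other way round makes the sides join \<open>a\<close> to \<open>d\<close> and \<open>b\<close> to \<open>c\<close>.  The
  result does not depend on the end that is chosen.
\<close>

definition petrial :: "'p ep_graph \<Rightarrow> 'p set \<Rightarrow> 'p ep_graph" where
  "petrial G e = G\<lparr>side := (\<lambda>p. if p \<in> e then seg G (side G p) else side G p)\<rparr>"

definition penrose_contract :: "'p ep_graph \<Rightarrow> 'p set \<Rightarrow> 'p ep_graph" where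
  "penrose_contract G e = contract (petrial G e) e"

text \<open>
  The operation is applied to the members of the finite set \<open>A\<close> one after the other.  All four
  operations above commute when they are applied to different edges, so the order does not matter.
\<close>

definition for_all_edges ::
    "('p ep_graph \<Rightarrow> 'p set \<Rightarrow> 'p ep_graph) \<Rightarrow> 'p ep_graph \<Rightarrow> 'p set set \<Rightarrow> 'p ep_graph" where
  "for_all_edges f G A = Finite_Set.fold (\<lambda>e H. f H e) G A"

definition resolve ::
    "'p ep_graph \<Rightarrow> 'p set set \<Rightarrow> 'p set set \<Rightarrow> 'p set set \<Rightarrow> 'p set set \<Rightarrow> 'p ep_graph" where
  "resolve G A B C D =
     for_all_edges penrose_contract
       (for_all_edges delete
         (for_all_edges contract
           (for_all_edges pinch G A) B) C) D"


subsection \<open>Connected components and boundary components\<close>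

definition classes :: "'p set \<Rightarrow> ('p \<times> 'p) set \<Rightarrow> 'p set set" where
  "classes S r = S // (r \<union> r\<inverse>)\<^sup>*"

definition same_disc :: "'p set set \<Rightarrow> ('p \<times> 'p) set" where
  "same_disc F = (\<Union>e\<in>F. e \<times> e)"

definition num_components :: "'p ep_graph \<Rightarrow> nat" ("\<kappa>") where
  "\<kappa> G = card (classes (points G)
     ({(p, arc G p) | p. p \<in> points G} \<union>
      {(p, seg G p) | p. p \<in> points G} \<union>
      same_disc (discs G)))"

text \<open>The part of the vertex boundaries that does not lie on an edge (of either colour).\<close>

definition free_vertex_boundary :: "'p ep_graph \<Rightarrow> ('p \<times> 'p) set" where
  "free_vertex_boundary G =
     {(p, arc G p) | p. p \<in> points G} \<union>
     {(p, seg G p) | p. p \<in> points G - corners G}"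

text \<open>
  The boundary of the edge-point ribbon graph consists of the free vertex boundary, the sides of
  the edges, and the singular points.  A dark disc has become a single point of this boundary, so
  its four corners are identified.  Every boundary component contains an arc, so that it suffices
  to count the classes of points.
\<close>

definition num_boundary_components :: "'p ep_graph \<Rightarrow> nat" ("\<partial>") where
  "\<partial> G = card (classes (points G)
     (free_vertex_boundary G \<union>
      {(p, side G p) | p. p \<in> \<Union> (edges G)} \<union>
      same_disc (dark G)))"


subsection \<open>Equivalence\<close>

definition isolated_vertices :: "'p ep_graph \<Rightarrow> 'p set set" where
  "isolated_vertices G = {K \<in> classes (points G) (free_vertex_boundary G). K \<inter> corners G = {}}"

text \<open>
  A homeomorphism is determined, up to isotopy and up to the choice of a bijection between the
  isolated vertices, by its effect on the corners.  Points that are not corners merely subdivide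
  the vertex boundaries and are disregarded.  Two corners are equivalent under the free vertex
  boundary iff they are the ends of a common component of it.  The sides of dark discs need not
  be preserved: this is what makes the equivalence one up to partial Petrials of dark discs.
\<close>

definition equivalent :: "'p ep_graph \<Rightarrow> 'q ep_graph \<Rightarrow> bool" (infix "\<cong>" 50) where
  "G \<cong> H \<longleftrightarrow>
     (\<exists>f. bij_betw f (corners G) (corners H) \<and>
          (\<lambda>e. f ` e) ` edges G = edges H \<and>
          (\<lambda>e. f ` e) ` dark G = dark H \<and>
          (\<forall>p\<in>corners G. f (seg G p) = seg H (f p)) \<and>
          (\<forall>p\<in>\<Union> (edges G). f (side G p) = side H (f p)) \<and>
          (\<forall>p\<in>corners G. \<forall>q\<in>corners G.
             (p, q) \<in> (free_vertex_boundary G \<union> (free_vertex_boundary G)\<inverse>)\<^sup>* \<longleftrightarrow>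
             (f p, f q) \<in> (free_vertex_boundary H \<union> (free_vertex_boundary H)\<inverse>)\<^sup>*)) \<and>
     card (isolated_vertices G) = card (isolated_vertices H)"


subsection \<open>The recursion\<close>

datatype indeterminate = Ind_w | Ind_x | Ind_y | Ind_z | Ind_t

type_synonym zpoly = "(indeterminate \<Rightarrow>\<^sub>0 nat) \<Rightarrow>\<^sub>0 int"

definition var :: "indeterminate \<Rightarrow> zpoly" where
  "var i = Poly_Mapping.single (Poly_Mapping.single i 1) 1"

abbreviation "w_var \<equiv> var Ind_w"
abbreviation "x_var \<equiv> var Ind_x"
abbreviation "y_var \<equiv> var Ind_y"
abbreviation "z_var \<equiv> var Ind_z"
abbreviation "t_var \<equiv> var Ind_t"

definition satisfies_recursion :: "('p ep_graph \<Rightarrow> zpoly) \<Rightarrow> bool" where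
  "satisfies_recursion \<Omega> \<longleftrightarrow>
     (\<forall>G. edge_point_ribbon_graph G \<longrightarrow>
        (\<forall>e\<in>edges G.
           \<Omega> G = w_var * \<Omega> (G \<odot> e) + x_var * \<Omega> (contract G e)
                + y_var * \<Omega> (delete G e) + z_var * \<Omega> (penrose_contract G e)) \<and>
        (edges G = {} \<longrightarrow> \<Omega> G = t_var ^ \<kappa> G))"

definition equivalence_invariant :: "('p ep_graph \<Rightarrow> zpoly) \<Rightarrow> bool" where
  "equivalence_invariant \<Omega> \<longleftrightarrow>
     (\<forall>G H. edge_point_ribbon_graph G \<longrightarrow> edge_point_ribbon_graph H \<longrightarrow> G \<cong> H \<longrightarrow> \<Omega> G = \<Omega> H)"

definition ordered_partitions :: "'a set \<Rightarrow> ('a set \<times> 'a set \<times> 'a set \<times> 'a set) set" where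
  "ordered_partitions E =
     {(A, B, C, D). A \<union> B \<union> C \<union> D = E \<and>
        A \<inter> B = {} \<and> A \<inter> C = {} \<and> A \<inter> D = {} \<and> B \<inter> C = {} \<and> B \<inter> D = {} \<and> C \<inter> D = {}}"

end

theory Submission imports Defs begin

text \<open>
  The right-hand side is a state sum: every edge independently chooses one of the four operations.
  Operations on different edges change the structure on disjoint sets of corners, so the result of
  making all choices has a closed form that does not refer to any order
  (\<open>resolve_eq\<close>).  Sorting the states by the choice made at a fixed edge \<open>e\<close> therefore splits the
  state sum into the four state sums of the graphs obtained by operating on \<open>e\<close>, which is the
  recursion (\<open>state_sum_recursion\<close>).  In an edgeless graph all discs are dark, and each is a single
  point of the boundary.  Two points of the graph are then connected exactly if they are connected
  within the boundary, so \<open>\<partial> = \<kappa>\<close> and the base cases agree.  Each step of the recursion removes an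
  edge, so it has only one solution on ribbon graphs (\<open>satisfies_recursion_unique\<close>), and this
  solution is the state sum.

  It remains to see that the state sum depends only on the equivalence class of the graph.  The
  boundary of a resolved graph is the free vertex boundary of the original one, with corners joined
  to each other in a way that the state prescribes (\<open>boundary_components_resolve\<close>).  An equivalence
  preserves which corners the free vertex boundary connects, and it carries the prescribed links to
  those of the corresponding state.  It thus matches the boundary components that contain a corner.
  The others are the isolated vertices, whose number is also preserved (\<open>card_classes_transport\<close>).
\<close>


section \<open>Ribbon graphs are closed under the operations\<close>

lemma edge_disc_mem:
  assumes "edge_disc G e" "p \<in> e"
  shows "seg G p \<in> e" "side G p \<in> e" "seg G (seg G p) = p" "side G (side G p) = p"
    "seg G p \<noteq> p" "side G p \<noteq> p" "side G p \<noteq> seg G p"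
  using assms by (auto simp: edge_disc_def perfect_matching_def)

text \<open>
  On four points, two fixed-point-free involutions that agree nowhere generate the Klein four-group.
  This is why giving an edge a half-twist at one end or the other has the same effect, and why the
  half-twisted sides again form a matching.
\<close>

lemma seg_side_commute:
  assumes "edge_disc G e" "p \<in> e"
  shows "side G (seg G p) = seg G (side G p)"
proof -
  have finite: "finite e" and four: "card e = 4"
    using assms by (auto simp: edge_disc_def intro: card_ge_0_finite)
  let ?X = "{p, seg G p, side G p, seg G (side G p)}"
  note rules = edge_disc_mem[OF assms(1)]
  have "p \<noteq> seg G (side G p)" "seg G p \<noteq> seg G (side G p)"
    using rules[OF assms(2)] rules[OF rules(2)[OF assms(2)]] by metis+
  then have "card ?X = 4"
    using rules[OF assms(2)] rules[OF rules(2)[OF assms(2)]] by auto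
  moreover have "?X \<subseteq> e" using rules assms(2) by auto
  ultimately have "e = ?X" using card_subset_eq[OF finite] four by metis
  moreover have "side G (seg G p) \<in> e" using rules assms(2) by auto
  ultimately show ?thesis
    using rules[OF assms(2)] rules[OF rules(1)[OF assms(2)]] by auto
qed

lemma ribbon_graph_finite_edges:
  assumes "edge_point_ribbon_graph G"
  shows "finite (edges G)"
proof -
  have "edges G \<subseteq> Pow (points G)"
    using assms by (auto simp: edge_point_ribbon_graph_def edges_def edge_disc_def)
  then show ?thesis
    using assms finite_subset by (auto simp: edge_point_ribbon_graph_def)
qed

lemma ribbon_graph_edge_disc:
  "edge_point_ribbon_graph G \<Longrightarrow> e \<in> discs G \<Longrightarrow> edge_disc G e"
  by (simp add: edge_point_ribbon_graph_def)

lemma ribbon_graph_disjoint: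
  "edge_point_ribbon_graph G \<Longrightarrow> e \<in> discs G \<Longrightarrow> f \<in> discs G \<Longrightarrow> p \<in> e \<Longrightarrow> p \<in> f \<Longrightarrow> e = f"
  unfolding edge_point_ribbon_graph_def by blast

lemma ribbon_graph_pinch:
  "edge_point_ribbon_graph G \<Longrightarrow> e \<in> edges G \<Longrightarrow> edge_point_ribbon_graph (G \<odot> e)"
  by (auto simp: edge_point_ribbon_graph_def edges_def pinch_def edge_disc_def)

lemma ribbon_graph_delete:
  "edge_point_ribbon_graph G \<Longrightarrow> e \<in> edges G \<Longrightarrow> edge_point_ribbon_graph (delete G e)"
  by (auto simp: edge_point_ribbon_graph_def edges_def delete_def edge_disc_def)

text \<open>
  Segments and sides both pair off the four corners of \<open>e\<close> among themselves, so rerouting the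
  vertex boundaries along the sides of \<open>e\<close> affects neither the other points nor the other discs.
\<close>

lemma ribbon_graph_contract:
  assumes G: "edge_point_ribbon_graph G" and e: "e \<in> edges G"
  shows "edge_point_ribbon_graph (contract G e)"
proof -
  have disc: "e \<in> discs G" "edge_disc G e"
    using e ribbon_graph_edge_disc[OF G] by (auto simp: edges_def)
  have seg: "perfect_matching (points G) (seg G)"
    using G by (simp add: edge_point_ribbon_graph_def)
  have sub: "e \<subseteq> points G" using disc by (simp add: edge_disc_def)
  have off: "seg G p \<notin> e" if "p \<in> points G" "p \<notin> e" for p
    using that seg edge_disc_mem(1)[OF disc(2), of "seg G p"] by (auto simp: perfect_matching_def)
  have "perfect_matching (points G) (\<lambda>p. if p \<in> e then side G p else seg G p)"
    using seg sub off edge_disc_mem[OF disc(2)]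
    by (auto simp: perfect_matching_def)
  moreover have "edge_disc (contract G e) f" if "f \<in> discs G" "f \<noteq> e" for f
  proof -
    have "p \<notin> e" if "p \<in> f" for p
      using ribbon_graph_disjoint[OF G] \<open>f \<in> discs G\<close> \<open>f \<noteq> e\<close> disc(1) that by blast
    then show ?thesis
      using ribbon_graph_edge_disc[OF G \<open>f \<in> discs G\<close>]
      by (auto simp: edge_disc_def contract_def perfect_matching_def)
  qed
  ultimately show ?thesis
    using G e by (auto simp: edge_point_ribbon_graph_def contract_def edges_def)
qed

lemma ribbon_graph_petrial:
  assumes G: "edge_point_ribbon_graph G" and e: "e \<in> edges G"
  shows "edge_point_ribbon_graph (petrial G e)"
proof -
  have disc: "e \<in> discs G" "edge_disc G e"
    using e ribbon_graph_edge_disc[OF G] by (auto simp: edges_def)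
  note rules = edge_disc_mem[OF disc(2)]
  have "edge_disc (petrial G e) f" if f: "f \<in> discs G" for f
  proof (cases "f = e")
    case True
    have "seg G (side G p) \<noteq> p" "seg G (side G (seg G (side G p))) = p"
      "seg G (side G p) \<noteq> seg G p" if "p \<in> e" for p
      using rules[OF that] rules[OF rules(2)[OF that]]
        seg_side_commute[OF disc(2) rules(2)[OF that]] by metis+
    then show ?thesis
      using disc(2) rules unfolding True
      by (auto simp: edge_disc_def petrial_def perfect_matching_def)
  next
    case False
    have "p \<notin> e" if "p \<in> f" for p
      using ribbon_graph_disjoint[OF G] f False disc(1) that by blast
    then show ?thesis
      using ribbon_graph_edge_disc[OF G f]
      by (auto simp: edge_disc_def petrial_def perfect_matching_def)
  qed
  then show ?thesis
    using G by (simp add: edge_point_ribbon_graph_def petrial_def)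
qed

lemma ribbon_graph_penrose_contract:
  assumes "edge_point_ribbon_graph G" "e \<in> edges G"
  shows "edge_point_ribbon_graph (penrose_contract G e)"
  using ribbon_graph_contract[OF ribbon_graph_petrial[OF assms]] assms(2)
  by (simp add: penrose_contract_def edges_def petrial_def)

lemma edges_operations [simp]:
  "edges (G \<odot> e) = edges G - {e}"
  "edges (contract G e) = edges G - {e}"
  "edges (delete G e) = edges G - {e}"
  "edges (penrose_contract G e) = edges G - {e}"
  by (auto simp: edges_def pinch_def contract_def delete_def penrose_contract_def petrial_def)


section \<open>Resolving all edges simultaneously\<close>

text \<open>
  Penrose-contractions along overlapping sets do not commute, so a fold of them is not covered by
  the general theory, which requires commutation on all records.  A formula \<open>h\<close> for the
  intermediate graphs that depends only on the set of edges already treated shows at once that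
  their order is irrelevant and what the result is.
\<close>

lemma for_all_edges_eqI:
  assumes "finite A" and "h {} = G"
    and step: "\<And>X e. X \<subseteq> A \<Longrightarrow> e \<in> A \<Longrightarrow> e \<notin> X \<Longrightarrow> f (h X) e = h (insert e X)"
  shows "for_all_edges f G A = h A"
proof -
  have all: "X \<subseteq> A \<longrightarrow> y = h X" if "fold_graph (\<lambda>e H. f H e) G X y" for X y
    using that by induction (auto simp: assms(2) step)
  obtain y where "fold_graph (\<lambda>e H. f H e) G A y"
    using finite_imp_fold_graph[OF \<open>finite A\<close>, of "\<lambda>e H. f H e" G] by blast
  with all have "fold_graph (\<lambda>e H. f H e) G A (h A)" by blast
  then have "(THE y. fold_graph (\<lambda>e H. f H e) G A y) = h A"
    using all by blast
  then show ?thesis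
    by (simp add: for_all_edges_def Finite_Set.fold_def \<open>finite A\<close>)
qed

lemma for_all_edges_pinch:
  assumes "finite A"
  shows "for_all_edges pinch G A = G\<lparr>dark := dark G \<union> A\<rparr>"
  by (rule for_all_edges_eqI[OF assms, where h = "\<lambda>X. G\<lparr>dark := dark G \<union> X\<rparr>"])
    (auto simp: pinch_def)

lemma for_all_edges_delete:
  assumes "finite A"
  shows "for_all_edges delete G A = G\<lparr>discs := discs G - A\<rparr>"
proof (rule for_all_edges_eqI[OF assms, where h = "\<lambda>X. G\<lparr>discs := discs G - X\<rparr>"], goal_cases)
  case 1
  then show ?case by simp
next
  case (2 X e)
  show ?case
    by (rule ep_graph.equality) (auto simp: delete_def)
qed

lemma for_all_edges_contract:
  assumes "finite A"
  shows "for_all_edges contract G A =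
    G\<lparr>seg := (\<lambda>p. if p \<in> \<Union> A then side G p else seg G p), discs := discs G - A\<rparr>"
proof (rule for_all_edges_eqI[OF assms, where h = "\<lambda>X. G\<lparr>seg :=
    (\<lambda>p. if p \<in> \<Union> X then side G p else seg G p), discs := discs G - X\<rparr>"], goal_cases)
  case 1
  then show ?case by simp
next
  case (2 X e)
  show ?case
    by (rule ep_graph.equality) (auto simp: contract_def fun_eq_iff)
qed

text \<open>
  A Penrose-contraction overwrites both \<open>seg\<close> and \<open>side\<close>, and it reads \<open>seg\<close> at the other end of a
  side.  Disjointness of the edges, together with the closure of each under \<open>side\<close>, ensures that it
  never reads a value that an earlier operation has overwritten.
\<close>

lemma for_all_edges_penrose_contract:
  assumes "finite A"
    and disjoint: "\<And>e f. e \<in> A \<Longrightarrow> f \<in> A \<Longrightarrow> e \<noteq> f \<Longrightarrow> e \<inter> f = {}"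
    and side: "\<And>e p. e \<in> A \<Longrightarrow> p \<in> e \<Longrightarrow> side G p \<in> e"
  shows "for_all_edges penrose_contract G A =
    G\<lparr>seg := (\<lambda>p. if p \<in> \<Union> A then seg G (side G p) else seg G p),
      side := (\<lambda>p. if p \<in> \<Union> A then seg G (side G p) else side G p),
      discs := discs G - A\<rparr>"
proof (rule for_all_edges_eqI[OF assms(1), where h = "\<lambda>X.
    G\<lparr>seg := (\<lambda>p. if p \<in> \<Union> X then seg G (side G p) else seg G p),
      side := (\<lambda>p. if p \<in> \<Union> X then seg G (side G p) else side G p),
      discs := discs G - X\<rparr>"], goal_cases)
  case 1
  then show ?case by simp
next
  case (2 X e)
  then have "p \<notin> \<Union> X" if "p \<in> e" for p using disjoint that by blast
  moreover have "side G p \<in> e" if "p \<in> e" for p using side 2 that by blast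
  ultimately show ?case
    by (intro ep_graph.equality ext) (auto simp: penrose_contract_def contract_def petrial_def)
qed

text \<open>
  At the corners of an edge that is not pinched, the choice made for it tells how the vertex
  boundary continues: along the sides of a contracted edge, along the segments of a deleted one, and
  along the diagonals \<open>seg G \<circ> side G\<close> of a Penrose-contracted one.
\<close>

lemma resolve_eq:
  assumes G: "edge_point_ribbon_graph G" and P: "(A, B, C, D) \<in> ordered_partitions (edges G)"
  shows "resolve G A B C D =
    G\<lparr>seg := (\<lambda>p. if p \<in> \<Union> D then seg G (side G p) else if p \<in> \<Union> B then side G p else seg G p),
      side := (\<lambda>p. if p \<in> \<Union> D then seg G (side G p) else side G p),
      discs := discs G - (B \<union> C \<union> D),
      dark := dark G \<union> A\<rparr>"
proof -
  have E: "A \<union> B \<union> C \<union> D = edges G" "B \<inter> D = {}"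
    using P by (auto simp: ordered_partitions_def)
  then have sub: "B \<subseteq> discs G" "D \<subseteq> discs G" by (auto simp: edges_def)
  have fin: "finite A" "finite B" "finite C" "finite D"
    using ribbon_graph_finite_edges[OF G] E(1) by (metis finite_Un)+
  have side: "side G p \<in> e" if "e \<in> D" "p \<in> e" for e p
    using that sub edge_disc_mem(2)[OF ribbon_graph_edge_disc[OF G]] by blast
  have disjoint: "e \<inter> f = {}" if "e \<in> D" "f \<in> D" "e \<noteq> f" for e f
    using that sub ribbon_graph_disjoint[OF G] by blast
  have off: "side G p \<notin> f" if "e \<in> D" "p \<in> e" "f \<in> B" for e f p
    using that side[OF that(1,2)] sub E(2) ribbon_graph_disjoint[OF G, of e f] by blast
  \<comment> \<open>The Penrose-contractions act last.  By disjointness they still find the segments of \<open>G\<close>, and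
    not those altered by contracting \<open>B\<close>.\<close>
  define K where "K = G\<lparr>dark := dark G \<union> A,
    seg := (\<lambda>p. if p \<in> \<Union> B then side G p else seg G p), discs := discs G - B - C\<rparr>"
  have "resolve G A B C D = for_all_edges penrose_contract K D"
    by (simp add: resolve_def for_all_edges_pinch fin for_all_edges_contract for_all_edges_delete K_def
        cong: if_cong)
  moreover have "\<dots> = K\<lparr>seg := (\<lambda>p. if p \<in> \<Union> D then seg K (side K p) else seg K p),
      side := (\<lambda>p. if p \<in> \<Union> D then seg K (side K p) else side K p), discs := discs K - D\<rparr>"
    by (rule for_all_edges_penrose_contract[OF fin(4) disjoint]) (use side in \<open>simp_all add: K_def\<close>)
  moreover have "seg K (side K p) = seg G (side G p)" if "p \<in> \<Union> D" for p
    using that off by (auto simp: K_def)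
  then have "(\<lambda>p. if p \<in> \<Union> D then seg K (side K p) else seg K p) =
      (\<lambda>p. if p \<in> \<Union> D then seg G (side G p) else if p \<in> \<Union> B then side G p else seg G p)"
    and "(\<lambda>p. if p \<in> \<Union> D then seg K (side K p) else side K p) =
      (\<lambda>p. if p \<in> \<Union> D then seg G (side G p) else side G p)"
    by (simp_all add: fun_eq_iff K_def)
  moreover have "discs K - D = discs G - (B \<union> C \<union> D)" by (auto simp: K_def)
  ultimately show ?thesis by (intro ep_graph.equality) (simp_all add: K_def)
qed


section \<open>The state sum satisfies the recursion\<close>

definition state_sum :: "'p ep_graph \<Rightarrow> zpoly" where
  "state_sum G = (\<Sum>(A, B, C, D) \<in> ordered_partitions (edges G).
     w_var ^ card A * x_var ^ card B * y_var ^ card C * z_var ^ card D *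
     t_var ^ \<partial> (resolve G A B C D))"

lemma finite_ordered_partitions:
  assumes "finite E"
  shows "finite (ordered_partitions E)"
proof (rule finite_subset)
  show "ordered_partitions E \<subseteq> Pow E \<times> Pow E \<times> Pow E \<times> Pow E"
    by (auto simp: ordered_partitions_def)
qed (use assms in simp)

lemma sum_ordered_partitions_insert:
  fixes h :: "'a set \<times> 'a set \<times> 'a set \<times> 'a set \<Rightarrow> 'b::comm_monoid_add"
  assumes "finite E" "e \<notin> E"
  shows "sum h (ordered_partitions (insert e E)) =
    (\<Sum>(A, B, C, D) \<in> ordered_partitions E. h (insert e A, B, C, D)) +
    (\<Sum>(A, B, C, D) \<in> ordered_partitions E. h (A, insert e B, C, D)) +
    (\<Sum>(A, B, C, D) \<in> ordered_partitions E. h (A, B, insert e C, D)) +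
    (\<Sum>(A, B, C, D) \<in> ordered_partitions E. h (A, B, C, insert e D))"
proof -
  let ?P = "ordered_partitions E"
  define a b c d :: "'a set \<times> 'a set \<times> 'a set \<times> 'a set \<Rightarrow> 'a set \<times> 'a set \<times> 'a set \<times> 'a set"
    where "a = (\<lambda>(A, B, C, D). (insert e A, B, C, D))"
      and "b = (\<lambda>(A, B, C, D). (A, insert e B, C, D))"
      and "c = (\<lambda>(A, B, C, D). (A, B, insert e C, D))"
      and "d = (\<lambda>(A, B, C, D). (A, B, C, insert e D))"
  note defs = a_def b_def c_def d_def
  have notin: "e \<notin> A" "e \<notin> B" "e \<notin> C" "e \<notin> D" if "(A, B, C, D) \<in> ?P" for A B C D
    using that assms(2) by (auto simp: ordered_partitions_def)
  have inj: "inj_on a ?P" "inj_on b ?P" "inj_on c ?P" "inj_on d ?P"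
    unfolding inj_on_def defs using notin by (auto simp: insert_ident)
  have disj: "a ` ?P \<inter> b ` ?P = {}" "(a ` ?P \<union> b ` ?P) \<inter> c ` ?P = {}"
    "(a ` ?P \<union> b ` ?P \<union> c ` ?P) \<inter> d ` ?P = {}"
    unfolding defs by (auto dest: notin)
  have "X \<in> a ` ?P \<union> b ` ?P \<union> c ` ?P \<union> d ` ?P" if X: "X \<in> ordered_partitions (insert e E)" for X
  proof -
    obtain A B C D where [simp]: "X = (A, B, C, D)" by (cases X)
    let ?r = "(A - {e}, B - {e}, C - {e}, D - {e})"
    have "e \<in> A \<union> B \<union> C \<union> D" using X by (auto simp: ordered_partitions_def)
    moreover have "?r \<in> ?P"
      using X assms(2) by (auto simp: ordered_partitions_def)
    moreover have "e \<in> A \<Longrightarrow> X = a ?r" "e \<in> B \<Longrightarrow> X = b ?r" "e \<in> C \<Longrightarrow> X = c ?r" "e \<in> D \<Longrightarrow> X = d ?r"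
      using X by (auto simp: ordered_partitions_def defs)
    ultimately show ?thesis by blast
  qed
  moreover have "a ` ?P \<union> b ` ?P \<union> c ` ?P \<union> d ` ?P \<subseteq> ordered_partitions (insert e E)"
    using assms(2) by (auto simp: ordered_partitions_def defs)
  ultimately have "ordered_partitions (insert e E) = a ` ?P \<union> b ` ?P \<union> c ` ?P \<union> d ` ?P"
    by blast
  then have "sum h (ordered_partitions (insert e E)) =
      sum h (a ` ?P) + sum h (b ` ?P) + sum h (c ` ?P) + sum h (d ` ?P)"
    using finite_ordered_partitions[OF assms(1)] disj by (simp add: sum.union_disjoint)
  also have "\<dots> = sum (h \<circ> a) ?P + sum (h \<circ> b) ?P + sum (h \<circ> c) ?P + sum (h \<circ> d) ?P"
    using inj by (simp add: sum.reindex)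
  finally show ?thesis
    by (simp add: defs comp_def case_prod_unfold)
qed

text \<open>
  Operating on \<open>e\<close> first gives the same closed form, since no other edge has a corner in \<open>e\<close>.
\<close>

lemma resolve_insert:
  assumes G: "edge_point_ribbon_graph G" and e: "e \<in> edges G"
    and P: "(A, B, C, D) \<in> ordered_partitions (edges G - {e})"
  shows "resolve G (insert e A) B C D = resolve (G \<odot> e) A B C D"
    and "resolve G A (insert e B) C D = resolve (contract G e) A B C D"
    and "resolve G A B (insert e C) D = resolve (delete G e) A B C D"
    and "resolve G A B C (insert e D) = resolve (penrose_contract G e) A B C D"
proof -
  have P': "(insert e A, B, C, D) \<in> ordered_partitions (edges G)"
    "(A, insert e B, C, D) \<in> ordered_partitions (edges G)"
    "(A, B, insert e C, D) \<in> ordered_partitions (edges G)"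
    "(A, B, C, insert e D) \<in> ordered_partitions (edges G)"
    using P e by (auto simp: ordered_partitions_def)
  have E: "A \<union> B \<union> C \<union> D = edges G - {e}" using P by (auto simp: ordered_partitions_def)
  have disc: "e \<in> discs G" using e by (auto simp: edges_def)
  have off: "p \<notin> e \<and> side G p \<notin> e" if "f \<in> B \<union> D" "p \<in> f" for f p
  proof -
    have "f \<in> discs G" "f \<noteq> e" using that(1) E by (auto simp: edges_def)
    then have "side G p \<in> f" "f \<inter> e = {}"
      using edge_disc_mem[OF ribbon_graph_edge_disc[OF G] that(2)]
        ribbon_graph_disjoint[OF G, of f e] disc by blast+
    then show ?thesis using that(2) by blast
  qed
  then have off_B: "f \<in> B \<Longrightarrow> p \<in> f \<Longrightarrow> p \<notin> e \<and> side G p \<notin> e"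
    and off_D: "f \<in> D \<Longrightarrow> p \<in> f \<Longrightarrow> p \<notin> e \<and> side G p \<notin> e" for f p
    by blast+
  show "resolve G (insert e A) B C D = resolve (G \<odot> e) A B C D"
    using P by (simp add: resolve_eq[OF G P'(1)] resolve_eq[OF ribbon_graph_pinch[OF G e]])
      (simp add: pinch_def cong: if_cong)
  show "resolve G A (insert e B) C D = resolve (contract G e) A B C D"
    using P
    by (simp add: resolve_eq[OF G P'(2)] resolve_eq[OF ribbon_graph_contract[OF G e]] del: Union_iff)
      (intro ep_graph.equality ext, auto simp: contract_def simp del: Union_iff dest: off_B off_D)
  show "resolve G A B (insert e C) D = resolve (delete G e) A B C D"
    using P by (simp add: resolve_eq[OF G P'(3)] resolve_eq[OF ribbon_graph_delete[OF G e]])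
      (intro ep_graph.equality ext, auto simp: delete_def)
  show "resolve G A B C (insert e D) = resolve (penrose_contract G e) A B C D"
    using P
    by (simp add: resolve_eq[OF G P'(4)] resolve_eq[OF ribbon_graph_penrose_contract[OF G e]]
        del: Union_iff)
      (intro ep_graph.equality ext, auto simp: penrose_contract_def petrial_def contract_def
        simp del: Union_iff dest: off_B off_D)
qed

lemma state_sum_recursion:
  assumes G: "edge_point_ribbon_graph G" and e: "e \<in> edges G"
  shows "state_sum G = w_var * state_sum (G \<odot> e) + x_var * state_sum (contract G e)
    + y_var * state_sum (delete G e) + z_var * state_sum (penrose_contract G e)"
proof -
  let ?E = "edges G - {e}"
  have fin: "finite ?E" using ribbon_graph_finite_edges[OF G] by simp
  have E: "edges G = insert e ?E" using e by blast
  have card: "card (insert e A) = Suc (card A)" "card (insert e B) = Suc (card B)"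
    "card (insert e C) = Suc (card C)" "card (insert e D) = Suc (card D)"
    if "(A, B, C, D) \<in> ordered_partitions ?E" for A B C D
  proof -
    have "A \<union> B \<union> C \<union> D = ?E" using that by (auto simp: ordered_partitions_def)
    then have "finite A" "finite B" "finite C" "finite D" "e \<notin> A \<union> B \<union> C \<union> D"
      using fin by (metis finite_Un)+ (auto simp: \<open>A \<union> B \<union> C \<union> D = ?E\<close>)
    then show "card (insert e A) = Suc (card A)" "card (insert e B) = Suc (card B)"
      "card (insert e C) = Suc (card C)" "card (insert e D) = Suc (card D)" by auto
  qed
  have "state_sum G = (\<Sum>(A, B, C, D) \<in> ordered_partitions (insert e ?E).
     w_var ^ card A * x_var ^ card B * y_var ^ card C * z_var ^ card D *
     t_var ^ \<partial> (resolve G A B C D))"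
    unfolding state_sum_def using E by simp
  also have "\<dots> = w_var * state_sum (G \<odot> e) + x_var * state_sum (contract G e)
    + y_var * state_sum (delete G e) + z_var * state_sum (penrose_contract G e)"
    unfolding state_sum_def edges_operations
    by (subst sum_ordered_partitions_insert[OF fin], simp, unfold sum_distrib_left,
        intro arg_cong2[where f = "(+)"] sum.cong refl)
      (auto simp: card resolve_insert[OF G e] algebra_simps)
  finally show ?thesis .
qed

text \<open>
  The segments on discs, which count for connectivity but not for the boundary, join two corners of
  a dark disc, and those are identified in the boundary anyway.
\<close>

lemma boundary_components_edgeless:
  assumes G: "edge_point_ribbon_graph G" and "edges G = {}"
  shows "\<partial> G = \<kappa> G"
proof -
  have dark: "discs G = dark G"
    using assms by (auto simp: edges_def edge_point_ribbon_graph_def)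
  have "(p, seg G p) \<in> same_disc (dark G)" if "p \<in> corners G" for p
    using that edge_disc_mem(1)[OF ribbon_graph_edge_disc[OF G]]
    by (auto simp: corners_def same_disc_def dark)
  then have "free_vertex_boundary G \<union> {(p, side G p) | p. p \<in> \<Union> (edges G)} \<union> same_disc (dark G)
    = {(p, arc G p) | p. p \<in> points G} \<union> {(p, seg G p) | p. p \<in> points G} \<union> same_disc (discs G)"
    using edge_point_ribbon_graph_def[of G] G
    by (auto simp: free_vertex_boundary_def assms(2) dark corners_def edge_disc_def)
  then show ?thesis by (simp add: num_boundary_components_def num_components_def)
qed

lemma state_sum_edgeless:
  assumes G: "edge_point_ribbon_graph G" and "edges G = {}"
  shows "state_sum G = t_var ^ \<kappa> G"
proof -
  have P: "ordered_partitions (edges G) = {({}, {}, {}, {})}"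
    by (auto simp: ordered_partitions_def assms(2))
  have "resolve G {} {} {} {} = G"
    by (subst resolve_eq[OF G]) (simp_all add: P)
  then show ?thesis
    by (simp add: state_sum_def P boundary_components_edgeless[OF assms])
qed

lemma satisfies_recursion_state_sum: "satisfies_recursion state_sum"
  unfolding satisfies_recursion_def
  using state_sum_recursion state_sum_edgeless by blast

lemma satisfies_recursion_unique:
  assumes \<Omega>: "satisfies_recursion \<Omega>" and \<Omega>': "satisfies_recursion \<Omega>'"
    and "edge_point_ribbon_graph G"
  shows "\<Omega> G = \<Omega>' G"
  using assms(3)
proof (induction "card (edges G)" arbitrary: G rule: less_induct)
  case less
  show ?case
  proof (cases "edges G = {}")
    case True
    then show ?thesis using \<Omega> \<Omega>' less.prems by (simp add: satisfies_recursion_def)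
  next
    case False
    then obtain e where e: "e \<in> edges G" by blast
    then have "card (edges G - {e}) < card (edges G)"
      using ribbon_graph_finite_edges[OF less.prems] by (meson card_Diff1_less)
    then have "\<Omega> (G \<odot> e) = \<Omega>' (G \<odot> e)" "\<Omega> (contract G e) = \<Omega>' (contract G e)"
      "\<Omega> (delete G e) = \<Omega>' (delete G e)" "\<Omega> (penrose_contract G e) = \<Omega>' (penrose_contract G e)"
      using less.hyps less.prems e
      by (simp_all add: ribbon_graph_pinch ribbon_graph_contract ribbon_graph_delete
          ribbon_graph_penrose_contract)
    then show ?thesis
      using \<Omega> \<Omega>' less.prems e by (simp add: satisfies_recursion_def)
  qed
qed


section \<open>The state sum is invariant under equivalence\<close>

definition equiv_closure :: "('p \<times> 'p) set \<Rightarrow> ('p \<times> 'p) set" where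
  "equiv_closure r = (r \<union> r\<inverse>)\<^sup>*"

lemma equiv_closure_refl [simp]: "(p, p) \<in> equiv_closure r"
  by (simp add: equiv_closure_def)

lemma equiv_closure_trans:
  "(p, q) \<in> equiv_closure r \<Longrightarrow> (q, s) \<in> equiv_closure r \<Longrightarrow> (p, s) \<in> equiv_closure r"
  unfolding equiv_closure_def by (rule rtrancl_trans)

lemma equiv_closure_sym: "(p, q) \<in> equiv_closure r \<Longrightarrow> (q, p) \<in> equiv_closure r"
  unfolding equiv_closure_def by (meson sym_Un_converse sym_rtrancl symD)

lemma equiv_closure_mono: "r \<subseteq> r' \<Longrightarrow> equiv_closure r \<subseteq> equiv_closure r'"
  unfolding equiv_closure_def by (rule rtrancl_mono) blast

lemma equiv_closure_class_eq:
  "equiv_closure r `` {p} = equiv_closure r `` {q} \<longleftrightarrow> (p, q) \<in> equiv_closure r"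
  by (auto dest: equiv_closure_trans equiv_closure_sym)

lemma classes_eq: "classes S r = (\<lambda>p. equiv_closure r `` {p}) ` S"
  by (auto simp: classes_def quotient_def equiv_closure_def)

text \<open>
  A path can use \<open>R\<close> only after it has reached \<open>K\<close>.
\<close>

lemma equiv_closure_no_link:
  assumes "R \<subseteq> K \<times> K" and "(p, q) \<in> equiv_closure (r \<union> R)"
    and "equiv_closure r `` {p} \<inter> K = {}"
  shows "(p, q) \<in> equiv_closure r"
  using assms(2) unfolding equiv_closure_def[of "r \<union> R"]
proof induction
  case base
  show ?case by simp
next
  case (step y z)
  then have "y \<notin> K" using assms(3) by blast
  then have "(y, z) \<in> r \<union> r\<inverse>" using step.hyps(2) assms(1) by blast
  then have "(y, z) \<in> equiv_closure r" unfolding equiv_closure_def by blast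
  with step.IH show ?case by (rule equiv_closure_trans)
qed

text \<open>
  The map \<open>f\<close> is meaningful only on \<open>K\<close>, whereas a path may leave \<open>K\<close>.  The excursions outside
  \<open>K\<close> consist of \<open>r\<close>-steps, so the proof follows the path while remembering a point \<open>c\<close> of \<open>K\<close>
  from which the current point is reachable by \<open>r\<close> alone, and moves \<open>c\<close> at each \<open>R\<close>-step.
\<close>

lemma equiv_closure_transport:
  assumes R: "R \<subseteq> K \<times> K"
    and r: "\<And>p q. p \<in> K \<Longrightarrow> q \<in> K \<Longrightarrow> (p, q) \<in> equiv_closure r \<Longrightarrow> (f p, f q) \<in> equiv_closure r'"
    and link: "\<And>p q. (p, q) \<in> R \<Longrightarrow> (f p, f q) \<in> R'"
    and "p \<in> K" "q \<in> K" "(p, q) \<in> equiv_closure (r \<union> R)"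
  shows "(f p, f q) \<in> equiv_closure (r' \<union> R')"
proof -
  have mono: "equiv_closure r' \<subseteq> equiv_closure (r' \<union> R')" by (rule equiv_closure_mono) blast
  have "\<exists>c\<in>K. (f p, f c) \<in> equiv_closure (r' \<union> R') \<and> (c, q) \<in> equiv_closure r"
    using assms(6) unfolding equiv_closure_def[of "r \<union> R"]
  proof induction
    case base
    show ?case using \<open>p \<in> K\<close> by (intro bexI[of _ p]) simp_all
  next
    case (step y z)
    then obtain c where c: "c \<in> K" "(f p, f c) \<in> equiv_closure (r' \<union> R')" "(c, y) \<in> equiv_closure r"
      by blast
    consider "(y, z) \<in> r \<union> r\<inverse>" | "(y, z) \<in> R \<union> R\<inverse>" using step.hyps(2) by blast
    then show ?case
    proof cases
      case 1
      then have "(y, z) \<in> equiv_closure r" unfolding equiv_closure_def by blast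
      with c(3) have "(c, z) \<in> equiv_closure r" by (rule equiv_closure_trans)
      with c show ?thesis by blast
    next
      case 2
      then have yz: "y \<in> K" "z \<in> K" using R by blast+
      then have "(f c, f y) \<in> equiv_closure (r' \<union> R')" using c r mono by blast
      moreover have "(f y, f z) \<in> R' \<union> R'\<inverse>" using 2 link by blast
      then have "(f y, f z) \<in> equiv_closure (r' \<union> R')" unfolding equiv_closure_def by blast
      ultimately show ?thesis
        using c(2) yz(2) by (intro bexI[of _ z]) (auto intro: equiv_closure_trans)
    qed
  qed
  then obtain c where c: "c \<in> K" "(f p, f c) \<in> equiv_closure (r' \<union> R')" "(c, q) \<in> equiv_closure r"
    by blast
  then have "(f c, f q) \<in> equiv_closure (r' \<union> R')" using r mono \<open>q \<in> K\<close> by blast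
  with c(2) show ?thesis by (rule equiv_closure_trans)
qed

lemma card_image_transport:
  assumes "bij_betw f K K'" and "\<And>p q. p \<in> K \<Longrightarrow> q \<in> K \<Longrightarrow> g p = g q \<longleftrightarrow> g' (f p) = g' (f q)"
  shows "card (g ` K) = card (g' ` K')"
proof -
  have inv: "inv_into K g (g p) \<in> K" "g (inv_into K g (g p)) = g p" if "p \<in> K" for p
    using that by (auto intro: inv_into_into f_inv_into_f)
  have "bij_betw (\<lambda>X. g' (f (inv_into K g X))) (g ` K) (g' ` f ` K)"
    unfolding bij_betw_def
  proof
    show "inj_on (\<lambda>X. g' (f (inv_into K g X))) (g ` K)"
      using inv assms(2) by (auto simp: inj_on_def)
    have "g' (f (inv_into K g (g p))) = g' (f p)" if "p \<in> K" for p
      using inv[OF that] assms(2) that by blast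
    then show "(\<lambda>X. g' (f (inv_into K g X))) ` g ` K = g' ` f ` K"
      by (auto simp: image_image)
  qed
  then show ?thesis using bij_betw_same_card assms(1) by (metis bij_betw_imp_surj_on)
qed

text \<open>
  With \<open>r\<close> the free vertex boundary, \<open>K\<close> the corners and \<open>R\<close> their links, the first summand
  counts the isolated vertices and the second one the boundary components through corners.
\<close>

lemma card_classes_split:
  assumes "finite S" "K \<subseteq> S" "R \<subseteq> K \<times> K"
  shows "card (classes S (r \<union> R)) =
    card {X \<in> classes S r. X \<inter> K = {}} + card ((\<lambda>p. equiv_closure (r \<union> R) `` {p}) ` K)"
proof -
  let ?c = "\<lambda>p. equiv_closure r `` {p}" and ?C = "\<lambda>p. equiv_closure (r \<union> R) `` {p}"
  have mono: "equiv_closure r \<subseteq> equiv_closure (r \<union> R)" by (rule equiv_closure_mono) blast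
  have same: "?C p = ?c p" if "?c p \<inter> K = {}" for p
    using equiv_closure_no_link[OF assms(3) _ that] mono by blast
  have meets: "?C p \<in> ?C ` K" if "?c p \<inter> K \<noteq> {}" for p
  proof -
    obtain q where "q \<in> K" "(p, q) \<in> equiv_closure r"
      using \<open>equiv_closure r `` {p} \<inter> K \<noteq> {}\<close> by fastforce
    then show ?thesis using mono equiv_closure_class_eq[of "r \<union> R" p q] by auto
  qed
  let ?I = "{X \<in> classes S r. X \<inter> K = {}}"
  have "classes S (r \<union> R) = ?I \<union> ?C ` K"
  proof
    show "classes S (r \<union> R) \<subseteq> ?I \<union> ?C ` K"
    proof
      fix X assume "X \<in> classes S (r \<union> R)"
      then obtain p where p: "p \<in> S" "X = ?C p" by (auto simp: classes_eq)
      show "X \<in> ?I \<union> ?C ` K"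
      proof (cases "?c p \<inter> K = {}")
        case True
        then show ?thesis using p same[of p] by (simp add: classes_eq)
      next
        case False
        then show ?thesis using p meets by blast
      qed
    qed
    show "?I \<union> ?C ` K \<subseteq> classes S (r \<union> R)"
    proof
      fix X assume "X \<in> ?I \<union> ?C ` K"
      then consider p where "p \<in> S" "X = ?c p" "?c p \<inter> K = {}" | p where "p \<in> K" "X = ?C p"
        by (auto simp: classes_eq)
      then show "X \<in> classes S (r \<union> R)"
        using same assms(2) by cases (auto simp: classes_eq)
    qed
  qed
  moreover have "p \<in> ?C p" for p by simp
  then have "?I \<inter> ?C ` K = {}" by blast
  moreover have "finite ?I" "finite (?C ` K)"
    using assms(1,2) finite_subset by (auto simp: classes_eq)
  ultimately show ?thesis by (simp add: card_Un_disjoint)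
qed

text \<open>
  The hypotheses on \<open>f\<close> are symmetric under passing to its inverse.  Hence transport of paths works in
  both directions, and \<open>f\<close> induces a bijection between the classes that meet \<open>K\<close> and those that
  meet \<open>K'\<close>.
\<close>

lemma card_classes_transport:
  assumes "finite S" "K \<subseteq> S" "R \<subseteq> K \<times> K" and "finite S'" "K' \<subseteq> S'" "R' \<subseteq> K' \<times> K'"
    and bij: "bij_betw f K K'"
    and r: "\<And>p q. p \<in> K \<Longrightarrow> q \<in> K \<Longrightarrow> (p, q) \<in> equiv_closure r \<longleftrightarrow> (f p, f q) \<in> equiv_closure r'"
    and link: "\<And>p q. p \<in> K \<Longrightarrow> q \<in> K \<Longrightarrow> (p, q) \<in> R \<longleftrightarrow> (f p, f q) \<in> R'"
    and isolated: "card {X \<in> classes S r. X \<inter> K = {}} = card {X \<in> classes S' r'. X \<inter> K' = {}}"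
  shows "card (classes S (r \<union> R)) = card (classes S' (r' \<union> R'))"
proof -
  let ?g = "inv_into K f"
  have g: "?g p \<in> K" "f (?g p) = p" if "p \<in> K'" for p
    using that bij by (auto simp: bij_betw_def intro: inv_into_into f_inv_into_f)
  have gf: "?g (f p) = p" if "p \<in> K" for p
    using that bij by (simp add: bij_betw_def)
  have f: "f p \<in> K'" if "p \<in> K" for p
    using that bij by (auto simp: bij_betw_def)
  have "(p, q) \<in> equiv_closure (r \<union> R) \<longleftrightarrow> (f p, f q) \<in> equiv_closure (r' \<union> R')"
    if pq: "p \<in> K" "q \<in> K" for p q
  proof
    assume "(p, q) \<in> equiv_closure (r \<union> R)"
    then show "(f p, f q) \<in> equiv_closure (r' \<union> R')"
      using equiv_closure_transport[OF assms(3), of r f r' R' p q] r link assms(3) pq by blast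
  next
    assume "(f p, f q) \<in> equiv_closure (r' \<union> R')"
    then have "(?g (f p), ?g (f q)) \<in> equiv_closure (r \<union> R)"
    proof (rule equiv_closure_transport[OF assms(6), rotated 4])
      show "(?g x, ?g y) \<in> equiv_closure r" if "x \<in> K'" "y \<in> K'" "(x, y) \<in> equiv_closure r'" for x y
        using that r[of "?g x" "?g y"] g by simp
      show "(?g x, ?g y) \<in> R" if "(x, y) \<in> R'" for x y
      proof -
        have "x \<in> K'" "y \<in> K'" using that assms(6) by auto
        then show ?thesis using that link[of "?g x" "?g y"] g by simp
      qed
    qed (use f pq in auto)
    then show "(p, q) \<in> equiv_closure (r \<union> R)" by (simp add: gf pq)
  qed
  then have "card ((\<lambda>p. equiv_closure (r \<union> R) `` {p}) ` K) =
      card ((\<lambda>p. equiv_closure (r' \<union> R') `` {p}) ` K')"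
    by (intro card_image_transport[OF bij]) (simp add: equiv_closure_class_eq)
  then show ?thesis
    unfolding card_classes_split[OF assms(1-3)] card_classes_split[OF assms(4-6)]
    using isolated by simp
qed

text \<open>
  How the boundary of \<open>resolve G A B C D\<close> joins the corners of \<open>G\<close>, apart from the free vertex
  boundary of \<open>G\<close>.  Everything is expressed by data of \<open>G\<close> that equivalences preserve; the sides
  of dark discs, which they need not preserve, do not occur.
\<close>

definition links ::
    "'p ep_graph \<Rightarrow> 'p set set \<Rightarrow> 'p set set \<Rightarrow> 'p set set \<Rightarrow> 'p set set \<Rightarrow> ('p \<times> 'p) set" where
  "links G A B C D =
     {(p, q) \<in> corners G \<times> corners G.
        (\<exists>e \<in> dark G \<union> A. p \<in> e \<and> q \<in> e) \<or> p \<in> \<Union> B \<and> q = side G p \<or>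
        p \<in> \<Union> C \<and> q = seg G p \<or> p \<in> \<Union> D \<and> q = seg G (side G p)}"

lemma corner_closed:
  assumes "edge_point_ribbon_graph G" "p \<in> corners G"
  shows "seg G p \<in> corners G" "side G p \<in> corners G"
  using assms edge_disc_mem[OF ribbon_graph_edge_disc[OF assms(1)]]
  unfolding corners_def by blast+

text \<open>
  When all edges are resolved, only the dark discs remain.  The segments on the contracted, deleted
  and Penrose-contracted edges have become free vertex boundary of the resolved graph, and these
  together with the singular points are exactly the links.
\<close>

lemma boundary_components_resolve:
  assumes G: "edge_point_ribbon_graph G" and P: "(A, B, C, D) \<in> ordered_partitions (edges G)"
  shows "\<partial> (resolve G A B C D) =
    card (classes (points G) (free_vertex_boundary G \<union> links G A B C D))"
proof -
  let ?H = "resolve G A B C D"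
  have E: "A \<union> B \<union> C \<union> D = edges G" and disj: "A \<inter> (B \<union> C \<union> D) = {}" "B \<inter> C = {}" "B \<inter> D = {}" "C \<inter> D = {}"
    using P by (auto simp: ordered_partitions_def)
  have dark: "dark G \<subseteq> discs G" using G by (simp add: edge_point_ribbon_graph_def)
  have discs: "discs G - (B \<union> C \<union> D) = dark G \<union> A"
    using E disj dark by (auto simp: edges_def)
  have cover: "discs G = dark G \<union> A \<union> B \<union> C \<union> D"
    using E dark by (auto simp: edges_def)
  note eq = resolve_eq[OF G P]
  have sub: "corners G \<subseteq> points G"
    using ribbon_graph_edge_disc[OF G] by (auto simp: corners_def edge_disc_def)
  have disjoint: "\<Union> X \<inter> \<Union> Y = {}" if "X \<inter> Y = {}" "X \<subseteq> discs G" "Y \<subseteq> discs G" for X Y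
  proof (rule equals0I)
    fix p assume "p \<in> \<Union> X \<inter> \<Union> Y"
    then obtain e f where ef: "e \<in> X" "p \<in> e" "f \<in> Y" "p \<in> f" by blast
    then have "e = f" using that(2,3) ribbon_graph_disjoint[OF G, of e f p] by blast
    then show False using ef that(1) by blast
  qed
  have "dark G \<inter> edges G = {}" by (auto simp: edges_def)
  then have sep: "\<Union> (dark G \<union> A) \<inter> \<Union> (B \<union> C \<union> D) = {}"
    "\<Union> B \<inter> \<Union> C = {}" "\<Union> B \<inter> \<Union> D = {}" "\<Union> C \<inter> \<Union> D = {}"
    using disj E cover by (intro disjoint; blast)+
  have corners: "corners G = \<Union> (dark G \<union> A) \<union> \<Union> B \<union> \<Union> C \<union> \<Union> D"
    using cover by (auto simp: corners_def)
  have H: "points ?H = points G" "arc ?H = arc G" "edges ?H = {}" "dark ?H = dark G \<union> A"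
    "corners ?H = \<Union> (dark G \<union> A)"
    by (auto simp: eq edges_def corners_def discs)
  let ?seg = "\<lambda>p. if p \<in> \<Union> D then seg G (side G p) else if p \<in> \<Union> B then side G p else seg G p"
  have "free_vertex_boundary ?H \<union> same_disc (dark G \<union> A) =
      {(p, arc G p) | p. p \<in> points G} \<union> {(p, ?seg p) | p. p \<in> points G - \<Union> (dark G \<union> A)} \<union>
      same_disc (dark G \<union> A)"
    unfolding free_vertex_boundary_def H by (simp add: eq)
  also have "{(p, ?seg p) | p. p \<in> points G - \<Union> (dark G \<union> A)} =
      {(p, seg G p) | p. p \<in> points G - corners G} \<union> {(p, side G p) | p. p \<in> \<Union> B} \<union>
      {(p, seg G p) | p. p \<in> \<Union> C} \<union> {(p, seg G (side G p)) | p. p \<in> \<Union> D}"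
  proof -
    have "points G - \<Union> (dark G \<union> A) = (points G - corners G) \<union> \<Union> B \<union> \<Union> C \<union> \<Union> D"
      using sep(1) sub unfolding corners by blast
    moreover have "p \<notin> \<Union> D" "p \<notin> \<Union> B" if "p \<in> points G - corners G" for p
      using that unfolding corners by blast+
    moreover have "p \<notin> \<Union> D" if "p \<in> \<Union> B" for p using that sep by blast
    moreover have "p \<notin> \<Union> D" "p \<notin> \<Union> B" if "p \<in> \<Union> C" for p using that sep by blast+
    ultimately show ?thesis
      unfolding Setcompr_eq_image
      by (simp only: image_Un)
        (intro arg_cong2[where f = "(\<union>)"] image_cong refl; simp del: Union_iff)
  qed
  also have "{(p, arc G p) | p. p \<in> points G} \<union>
      ({(p, seg G p) | p. p \<in> points G - corners G} \<union> {(p, side G p) | p. p \<in> \<Union> B} \<union>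
      {(p, seg G p) | p. p \<in> \<Union> C} \<union> {(p, seg G (side G p)) | p. p \<in> \<Union> D}) \<union>
      same_disc (dark G \<union> A) = free_vertex_boundary G \<union> links G A B C D"
  proof -
    have mem: "(p, q) \<in> links G A B C D \<longleftrightarrow>
        (\<exists>e \<in> dark G \<union> A. p \<in> e \<and> q \<in> e) \<or> p \<in> \<Union> B \<and> q = side G p \<or>
        p \<in> \<Union> C \<and> q = seg G p \<or> p \<in> \<Union> D \<and> q = seg G (side G p)" for p q
    proof -
      have "p \<in> corners G" if "p \<in> \<Union> B \<or> p \<in> \<Union> C \<or> p \<in> \<Union> D" using that corners by blast
      moreover have "x \<in> corners G" if "e \<in> dark G \<union> A" "x \<in> e" for x e using that corners by blast
      ultimately show ?thesis
        using corner_closed[OF G, of p] corner_closed(1)[OF G, of "side G p"]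
        unfolding links_def by blast
    qed
    have "links G A B C D = {(p, side G p) | p. p \<in> \<Union> B} \<union>
      {(p, seg G p) | p. p \<in> \<Union> C} \<union> {(p, seg G (side G p)) | p. p \<in> \<Union> D} \<union>
      same_disc (dark G \<union> A)"
      by (auto simp: mem same_disc_def)
    then show ?thesis by (auto simp: free_vertex_boundary_def)
  qed
  finally show ?thesis
    by (simp add: num_boundary_components_def H)
qed

lemma ordered_partitions_bij:
  assumes "bij_betw F E E'"
  shows "bij_betw (\<lambda>(A, B, C, D). (F ` A, F ` B, F ` C, F ` D))
    (ordered_partitions E) (ordered_partitions E')"
proof (rule bij_betw_byWitness[where f' = "\<lambda>(A, B, C, D).
    (inv_into E F ` A, inv_into E F ` B, inv_into E F ` C, inv_into E F ` D)"])
  have *: "(F ` A, F ` B, F ` C, F ` D) \<in> ordered_partitions E'"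
    if "bij_betw F E E'" "(A, B, C, D) \<in> ordered_partitions E"
    for F A B C D and E :: "'c set" and E' :: "'d set"
  proof -
    have inj: "inj_on F E" and im: "F ` E = E'" using that(1) by (auto simp: bij_betw_def)
    have E: "A \<union> B \<union> C \<union> D = E" using that(2) by (auto simp: ordered_partitions_def)
    have "F ` X \<inter> F ` Y = {}" if "X \<inter> Y = {}" "X \<subseteq> E" "Y \<subseteq> E" for X Y
      using inj_on_image_Int[OF inj that(2,3)] that(1) by simp
    moreover have "F ` A \<union> F ` B \<union> F ` C \<union> F ` D = E'" using E im by blast
    ultimately show ?thesis using that(2) E by (auto simp: ordered_partitions_def)
  qed
  show "(\<lambda>(A, B, C, D). (F ` A, F ` B, F ` C, F ` D)) ` ordered_partitions E \<subseteq> ordered_partitions E'"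
    using *[OF assms] by auto
  show "(\<lambda>(A, B, C, D). (inv_into E F ` A, inv_into E F ` B, inv_into E F ` C, inv_into E F ` D))
      ` ordered_partitions E' \<subseteq> ordered_partitions E"
    using *[OF bij_betw_inv_into[OF assms]] by auto
  have sub: "A \<subseteq> E" "B \<subseteq> E" "C \<subseteq> E" "D \<subseteq> E" if "(A, B, C, D) \<in> ordered_partitions E"
    for A B C D and E :: "'c set"
    using that by (auto simp: ordered_partitions_def)
  have inv: "inv_into E F ` F ` X = X" if "X \<subseteq> E" for X
    using assms that by (simp add: bij_betw_def inv_into_image_cancel)
  have inv': "F ` inv_into E F ` X = X" if "X \<subseteq> E'" for X
    using assms that by (simp add: bij_betw_def image_inv_into_cancel)
  show "\<forall>X\<in>ordered_partitions E. (\<lambda>(A, B, C, D). (inv_into E F ` A, inv_into E F ` B,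
      inv_into E F ` C, inv_into E F ` D)) ((\<lambda>(A, B, C, D). (F ` A, F ` B, F ` C, F ` D)) X) = X"
  proof
    fix X assume X: "X \<in> ordered_partitions E"
    obtain A B C D where eq: "X = (A, B, C, D)" by (cases X)
    show "(\<lambda>(A, B, C, D). (inv_into E F ` A, inv_into E F ` B, inv_into E F ` C, inv_into E F ` D))
        ((\<lambda>(A, B, C, D). (F ` A, F ` B, F ` C, F ` D)) X) = X"
      using inv sub[OF X[unfolded eq]] by (simp only: eq prod.case)
  qed
  show "\<forall>X\<in>ordered_partitions E'. (\<lambda>(A, B, C, D). (F ` A, F ` B, F ` C, F ` D))
      ((\<lambda>(A, B, C, D). (inv_into E F ` A, inv_into E F ` B, inv_into E F ` C, inv_into E F ` D)) X) = X"
  proof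
    fix X assume X: "X \<in> ordered_partitions E'"
    obtain A B C D where eq: "X = (A, B, C, D)" by (cases X)
    show "(\<lambda>(A, B, C, D). (F ` A, F ` B, F ` C, F ` D)) ((\<lambda>(A, B, C, D).
        (inv_into E F ` A, inv_into E F ` B, inv_into E F ` C, inv_into E F ` D)) X) = X"
      using inv' sub[OF X[unfolded eq]] by (simp only: eq prod.case)
  qed
qed

lemma links_equivalent:
  assumes G: "edge_point_ribbon_graph G"
    and P: "(A, B, C, D) \<in> ordered_partitions (edges G)"
    and bij: "bij_betw f (corners G) (corners H)"
    and dark: "(\<lambda>e. f ` e) ` dark G = dark H"
    and seg: "\<And>p. p \<in> corners G \<Longrightarrow> f (seg G p) = seg H (f p)"
    and side: "\<And>p. p \<in> \<Union> (edges G) \<Longrightarrow> f (side G p) = side H (f p)"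
    and pq: "p \<in> corners G" "q \<in> corners G"
  shows "(p, q) \<in> links G A B C D \<longleftrightarrow>
    (f p, f q) \<in> links H ((`) f ` A) ((`) f ` B) ((`) f ` C) ((`) f ` D)"
proof -
  have inj: "inj_on f (corners G)" using bij by (simp add: bij_betw_def)
  have E: "A \<union> B \<union> C \<union> D = edges G" using P by (auto simp: ordered_partitions_def)
  have sub: "e \<subseteq> corners G" if "e \<in> dark G \<union> A \<union> B \<union> C \<union> D" for e
    using that E G by (auto simp: corners_def edges_def edge_point_ribbon_graph_def)
  have mem: "f r \<in> f ` e \<longleftrightarrow> r \<in> e" if "r \<in> corners G" "e \<in> dark G \<union> A \<union> B \<union> C \<union> D" for r e
    using inj_on_image_mem_iff[OF inj that(1) sub[OF that(2)]] .
  have Union: "f p \<in> \<Union> ((`) f ` X) \<longleftrightarrow> p \<in> \<Union> X" if "X \<subseteq> A \<union> B \<union> C \<union> D" for X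
    using mem[OF pq(1)] that by blast
  have dark': "dark H \<union> (`) f ` A = (`) f ` (dark G \<union> A)" using dark by (simp add: image_Un)
  have fp: "f p \<in> corners H" "f q \<in> corners H" using bij pq by (auto simp: bij_betw_def)
  have eq: "f q = f r \<longleftrightarrow> q = r" if "r \<in> corners G" for r
    using inj pq that by (auto simp: inj_on_def)
  note closed = corner_closed[OF G]
  have 1: "(\<exists>e \<in> dark H \<union> (`) f ` A. f p \<in> e \<and> f q \<in> e) \<longleftrightarrow> (\<exists>e \<in> dark G \<union> A. p \<in> e \<and> q \<in> e)"
    unfolding dark' using mem pq by auto
  have light: "side H (f p) = f (side G p)" if "p \<in> \<Union> X" "X \<subseteq> A \<union> B \<union> C \<union> D" for X
  proof -
    have "p \<in> \<Union> (edges G)" using that unfolding E by blast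
    from side[OF this] show ?thesis by simp
  qed
  have B: "B \<subseteq> A \<union> B \<union> C \<union> D" and C: "C \<subseteq> A \<union> B \<union> C \<union> D"
    and D: "D \<subseteq> A \<union> B \<union> C \<union> D" by blast+
  have 2: "f p \<in> \<Union> ((`) f ` B) \<and> f q = side H (f p) \<longleftrightarrow> p \<in> \<Union> B \<and> q = side G p"
    using Union[OF B] light[OF _ B] eq[OF closed(2)[OF pq(1)]]
    by (cases "p \<in> \<Union> B") (simp_all del: Union_iff UN_iff)
  have 3: "f p \<in> \<Union> ((`) f ` C) \<and> f q = seg H (f p) \<longleftrightarrow> p \<in> \<Union> C \<and> q = seg G p"
    using Union[OF C] seg[OF pq(1)] eq[OF closed(1)[OF pq(1)]]
    by (cases "p \<in> \<Union> C") (simp_all del: Union_iff UN_iff)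
  have 4: "f p \<in> \<Union> ((`) f ` D) \<and> f q = seg H (side H (f p)) \<longleftrightarrow> p \<in> \<Union> D \<and> q = seg G (side G p)"
    using Union[OF D] light[OF _ D] seg[OF closed(2)[OF pq(1)]]
      eq[OF closed(1)[OF closed(2)[OF pq(1)]]]
    by (cases "p \<in> \<Union> D") (simp_all del: Union_iff UN_iff)
  show ?thesis
    unfolding links_def using 1 2 3 4 pq fp by simp
qed

lemma state_sum_equivalent:
  assumes G: "edge_point_ribbon_graph G" and H: "edge_point_ribbon_graph H" and "G \<cong> H"
  shows "state_sum G = state_sum H"
proof -
  obtain f where bij: "bij_betw f (corners G) (corners H)"
    and edges: "(\<lambda>e. f ` e) ` edges G = edges H" and dark: "(\<lambda>e. f ` e) ` dark G = dark H"
    and seg: "\<forall>p\<in>corners G. f (seg G p) = seg H (f p)"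
    and side: "\<forall>p\<in>\<Union> (edges G). f (side G p) = side H (f p)"
    and free: "\<forall>p\<in>corners G. \<forall>q\<in>corners G.
      (p, q) \<in> equiv_closure (free_vertex_boundary G) \<longleftrightarrow>
      (f p, f q) \<in> equiv_closure (free_vertex_boundary H)"
    and isolated: "card (isolated_vertices G) = card (isolated_vertices H)"
    using \<open>G \<cong> H\<close>[unfolded equivalent_def, folded equiv_closure_def]
    by (elim conjE exE) (rule that; assumption)
  have "edges G \<subseteq> Pow (corners G)" by (auto simp: edges_def corners_def)
  moreover have "inj_on ((`) f) (Pow (corners G))"
    using bij by (simp add: bij_betw_def inj_on_image_Pow)
  ultimately have F: "bij_betw ((`) f) (edges G) (edges H)"
    using edges by (auto simp: bij_betw_def intro: inj_on_subset)
  have finite: "finite (points K)" and sub: "corners K \<subseteq> points K" if "edge_point_ribbon_graph K" for K :: "'c ep_graph"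
    using that by (auto simp: edge_point_ribbon_graph_def corners_def edge_disc_def)
  have "state_sum H = (\<Sum>X \<in> ordered_partitions (edges G). case X of (A, B, C, D) \<Rightarrow>
      w_var ^ card ((`) f ` A) * x_var ^ card ((`) f ` B) * y_var ^ card ((`) f ` C) * z_var ^ card ((`) f ` D) *
      t_var ^ \<partial> (resolve H ((`) f ` A) ((`) f ` B) ((`) f ` C) ((`) f ` D)))"
    unfolding state_sum_def sum.reindex_bij_betw[OF ordered_partitions_bij[OF F], symmetric]
    by (simp add: case_prod_unfold)
  also have "\<dots> = state_sum G"
    unfolding state_sum_def
  proof (rule sum.cong[OF refl], clarify)
    fix A B C D assume P: "(A, B, C, D) \<in> ordered_partitions (edges G)"
    then have P': "((`) f ` A, (`) f ` B, (`) f ` C, (`) f ` D) \<in> ordered_partitions (edges H)"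
      using bij_betwE[OF ordered_partitions_bij[OF F]] by fastforce
    have card: "card ((`) f ` X) = card X" if "X \<subseteq> edges G" for X
      using F that by (auto simp: bij_betw_def intro: card_image inj_on_subset)
    have E: "A \<subseteq> edges G" "B \<subseteq> edges G" "C \<subseteq> edges G" "D \<subseteq> edges G"
      using P by (auto simp: ordered_partitions_def)
    have "\<partial> (resolve G A B C D) = \<partial> (resolve H ((`) f ` A) ((`) f ` B) ((`) f ` C) ((`) f ` D))"
      unfolding boundary_components_resolve[OF G P] boundary_components_resolve[OF H P']
    proof (rule card_classes_transport[OF finite[OF G] sub[OF G] _ finite[OF H] sub[OF H] _ bij
          bspec[OF bspec[OF free]] links_equivalent[OF G P bij dark bspec[OF seg] bspec[OF side]]])
      show "card {X \<in> classes (points G) (free_vertex_boundary G). X \<inter> corners G = {}} =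
          card {X \<in> classes (points H) (free_vertex_boundary H). X \<inter> corners H = {}}"
        using isolated by (simp add: isolated_vertices_def)
    qed (auto simp: links_def)
    then show "w_var ^ card ((`) f ` A) * x_var ^ card ((`) f ` B) * y_var ^ card ((`) f ` C) *
        z_var ^ card ((`) f ` D) * t_var ^ \<partial> (resolve H ((`) f ` A) ((`) f ` B) ((`) f ` C) ((`) f ` D)) =
        w_var ^ card A * x_var ^ card B * y_var ^ card C * z_var ^ card D * t_var ^ \<partial> (resolve G A B C D)"
      by (simp add: card E)
  qed
  finally show ?thesis by simp
qed

theorem theorem3p3:
  "(\<exists>\<Omega> :: 'p ep_graph \<Rightarrow> zpoly. satisfies_recursion \<Omega> \<and> equivalence_invariant \<Omega>) \<and>
   (\<forall>\<Omega> :: 'p ep_graph \<Rightarrow> zpoly. satisfies_recursion \<Omega> \<longrightarrow>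
      (\<forall>G. edge_point_ribbon_graph G \<longrightarrow>
         \<Omega> G = (\<Sum>(A, B, C, D) \<in> ordered_partitions (edges G).
                   w_var ^ card A * x_var ^ card B * y_var ^ card C * z_var ^ card D *
                   t_var ^ \<partial> (resolve G A B C D))))"
proof (intro conjI allI impI)
  have "equivalence_invariant (state_sum :: 'p ep_graph \<Rightarrow> zpoly)"
    unfolding equivalence_invariant_def using state_sum_equivalent by blast
  then show "\<exists>\<Omega> :: 'p ep_graph \<Rightarrow> zpoly. satisfies_recursion \<Omega> \<and> equivalence_invariant \<Omega>"
    using satisfies_recursion_state_sum by blast
next
  fix \<Omega> :: "'p ep_graph \<Rightarrow> zpoly" and G :: "'p ep_graph"
  assume "satisfies_recursion \<Omega>" "edge_point_ribbon_graph G"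
  then show "\<Omega> G = (\<Sum>(A, B, C, D) \<in> ordered_partitions (edges G).
      w_var ^ card A * x_var ^ card B * y_var ^ card C * z_var ^ card D *
      t_var ^ \<partial> (resolve G A B C D))"
    using satisfies_recursion_unique[OF _ satisfies_recursion_state_sum] state_sum_def by metis
qed

end
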